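(* Let $\varphi:A\to B$ be a surjective homomorphism between two finite groups $A$ and $B$, and let $S_1$ be a symmetric system of generators of $B$. Let $\widetilde S_1$ be an $S_1$-transversal section of $\varphi$, let $S_0$ be an admissible symmetric system of generators of $\ker(\varphi)$, and let $S_\varphi=S_0\cup\widetilde S_1$ be the resulting system of generators of $A$ induced by $\varphi$ and $S_1$. Then the triple $(Cay(A,S_\varphi),\varphi,Cay(B,S_1))$ is a $Cay(\ker(\varphi),S_0)$-graph bundle.
   Context: Groups and Cayley graphs. Every generating set considered does not contain the identity. A set $S$ in a group is symmetric if $s\in S$ implies $s^{-1}\in S$. For a finite group $G$ and a symmetric system of generators $S$ with $1_G\notin S$, $Cay(G,S)$ is the graph with vertex set $G$ and $x\sim y$ iff $y=xs$ for some $s\in S$. For a surjective homomorphism $\varphi:A\to B$ of finite groups and a symmetric system of generators $S_1=\{s_1,\dots,s_n\}$ of $B$ (distinct elements), an $S_1$-transversal section of $\varphi$ is a symmetric subset $\widetilde S_1=\{\widetilde s_1,\dots,\widetilde s_n\}$ of $A$ with $\varphi(\widetilde s_i)=s_i$ for each $i$. A symmetric system of generators $S_0$ of $\ker(\varphi)$ is admissible if $aS_0a^{-1}\subseteq S_0$ for every $a\in A$. Graphs are simple and undirected; $v\sim w$ denotes adjacency. A morphism of graphs $f:\Gamma_1\to\Gamma_2$ is a function $f:V_{\Gamma_1}\to V_{\Gamma_2}$ such that $v\sim w$ implies $f(v)\sim f(w)$ or $f(v)=f(w)$; it is surjective if it is surjective on vertices. An isomorphism of graphs is a bijection on vertices with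 $v\sim w$ iff $f(v)\sim f(w)$. The neighborhood $N(v)$ of a vertex $v$ is the graph with vertices $v$ and all $w\sim v$, and edges $\{v,w\}$ for $w\sim v$. For a natural number $k$, a triple $(\widetilde\Gamma,p,\Gamma)$ with $p:\widetilde\Gamma\to\Gamma$ a surjective morphism of graphs is a $k$-fold covering if each $p^{-1}(v)$ has exactly $k$ vertices and, for each vertex $x$ of $\widetilde\Gamma$, $p$ restricts to an isomorphism $N(x)\to N(p(x))$. For $v\sim w$ in $\Gamma$ the covering induces a bijection $\psi_{vw}:p^{-1}(v)\to p^{-1}(w)$ sending $x$ to the unique neighbour of $x$ in $\widetilde\Gamma$ lying over $w$. Graph bundles. Let $p:X\to\Gamma$ be a surjective morphism of graphs. The fiber $p^{-1}(v)$ is the subgraph of $X$ induced on the preimage of $v$. Let $\widetilde X$ be the graph with vertex set $V_X$ whose edges are the edges $\{x,y\}$ of $X$ with $p(x)\ne p(y)$, and let $\widetilde p:\widetilde X\to\Gamma$ be the map $p$. Given a graph $F$, $(X,p,\Gamma)$ is an $F$-graph bundle if (1) each fiber $p^{-1}(v)$ is isomorphic to $F$; (2) $\widetilde p:\widetilde X\to\Gamma$ is a $|V_F|$-fold covering; (3) for all $v\sim w$ in $\Gamma$ the bijection $\psi_{vw}:p^{-1}(v)\to p^{-1}(w)$ induced by this covering is an isomorphism of graphs. *)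

theory Defs
  imports "HOL-Algebra.Generated_Groups" "Graph_Theory.Pair_Digraph"
begin

text \<open>
  A simple undirected graph, possibly infinite, is a \<^typ>\<open>'a pair_pre_digraph\<close> satisfying
  \<^const>\<open>pair_bidirected_digraph\<close>: the arc relation \<^const>\<open>parcs\<close> is then the adjacency
  relation, a symmetric irreflexive relation on the vertex set.
  Maps between vertex sets are total HOL functions, used only on vertices.
\<close>

subsection \<open>Graphs and coverings\<close>

definition graph_morphism :: "'a pair_pre_digraph \<Rightarrow> ('a \<Rightarrow> 'b) \<Rightarrow> 'b pair_pre_digraph \<Rightarrow> bool" where
  "graph_morphism G f H \<longleftrightarrow>
     pair_bidirected_digraph G \<and> pair_bidirected_digraph H \<and>
     f \<in> pverts G \<rightarrow> pverts H \<and>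
     (\<forall>v w. (v, w) \<in> parcs G \<longrightarrow> (f v, f w) \<in> parcs H \<or> f v = f w)"

definition surj_graph_morphism :: "'a pair_pre_digraph \<Rightarrow> ('a \<Rightarrow> 'b) \<Rightarrow> 'b pair_pre_digraph \<Rightarrow> bool" where
  "surj_graph_morphism G f H \<longleftrightarrow> graph_morphism G f H \<and> f ` pverts G = pverts H"

definition graph_iso :: "'a pair_pre_digraph \<Rightarrow> ('a \<Rightarrow> 'b) \<Rightarrow> 'b pair_pre_digraph \<Rightarrow> bool" where
  "graph_iso G f H \<longleftrightarrow>
     pair_bidirected_digraph G \<and> pair_bidirected_digraph H \<and>
     bij_betw f (pverts G) (pverts H) \<and>
     (\<forall>v\<in>pverts G. \<forall>w\<in>pverts G. (v, w) \<in> parcs G \<longleftrightarrow> (f v, f w) \<in> parcs H)"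

definition isomorphic_graphs :: "'a pair_pre_digraph \<Rightarrow> 'b pair_pre_digraph \<Rightarrow> bool" where
  "isomorphic_graphs G H \<longleftrightarrow> (\<exists>f. graph_iso G f H)"

text \<open>The neighborhood is a star: edges between two neighbours of \<open>v\<close> are not included.\<close>

definition neighborhood :: "'a pair_pre_digraph \<Rightarrow> 'a \<Rightarrow> 'a pair_pre_digraph" where
  "neighborhood G v =
     \<lparr> pverts = insert v {w. (v, w) \<in> parcs G},
       parcs = {(x, y). (x, y) \<in> parcs G \<and> (x = v \<or> y = v)} \<rparr>"

definition fiber_set :: "'a pair_pre_digraph \<Rightarrow> ('a \<Rightarrow> 'b) \<Rightarrow> 'b \<Rightarrow> 'a set" where
  "fiber_set X p v = {x \<in> pverts X. p x = v}"

definition fiber_graph :: "'a pair_pre_digraph \<Rightarrow> ('a \<Rightarrow> 'b) \<Rightarrow> 'b \<Rightarrow> 'a pair_pre_digraph" where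
  "fiber_graph X p v =
     \<lparr> pverts = fiber_set X p v,
       parcs = {(x, y) \<in> parcs X. x \<in> fiber_set X p v \<and> y \<in> fiber_set X p v} \<rparr>"

text \<open>Finiteness is explicit because \<^const>\<open>card\<close> is \<open>0\<close> on infinite sets.\<close>

definition fold_covering ::
    "nat \<Rightarrow> 'a pair_pre_digraph \<Rightarrow> ('a \<Rightarrow> 'b) \<Rightarrow> 'b pair_pre_digraph \<Rightarrow> bool" where
  "fold_covering k X p G \<longleftrightarrow>
     surj_graph_morphism X p G \<and>
     (\<forall>v\<in>pverts G. finite (fiber_set X p v) \<and> card (fiber_set X p v) = k) \<and>
     (\<forall>x\<in>pverts X. graph_iso (neighborhood X x) p (neighborhood G (p x)))"

text \<open>
  For a covering \<open>p\<close> of \<open>G\<close> by \<open>X\<close>, an edge from \<open>v\<close> to \<open>w\<close> in \<open>G\<close> and \<open>x\<close> in the fiber over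
  \<open>v\<close>, the value at \<open>x\<close> of the induced bijection from the fiber over \<open>v\<close> to the fiber over \<open>w\<close>
  (it depends on \<open>v\<close> only through \<open>x\<close>).
\<close>

definition fiber_transport :: "'a pair_pre_digraph \<Rightarrow> ('a \<Rightarrow> 'b) \<Rightarrow> 'b \<Rightarrow> 'a \<Rightarrow> 'a" where
  "fiber_transport X p w x = (THE y. (x, y) \<in> parcs X \<and> p y = w)"

subsection \<open>Graph bundles\<close>

definition horizontal_graph :: "'a pair_pre_digraph \<Rightarrow> ('a \<Rightarrow> 'b) \<Rightarrow> 'a pair_pre_digraph" where
  "horizontal_graph X p =
     \<lparr> pverts = pverts X, parcs = {(x, y) \<in> parcs X. p x \<noteq> p y} \<rparr>"

definition graph_bundle ::
    "'c pair_pre_digraph \<Rightarrow> 'a pair_pre_digraph \<Rightarrow> ('a \<Rightarrow> 'b) \<Rightarrow> 'b pair_pre_digraph \<Rightarrow> bool" where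
  "graph_bundle F X p G \<longleftrightarrow>
     pair_bidirected_digraph F \<and> finite (pverts F) \<and>
     surj_graph_morphism X p G \<and>
     (\<forall>v\<in>pverts G. isomorphic_graphs (fiber_graph X p v) F) \<and>
     fold_covering (card (pverts F)) (horizontal_graph X p) p G \<and>
     (\<forall>v w. (v, w) \<in> parcs G \<longrightarrow>
        graph_iso (fiber_graph X p v) (fiber_transport (horizontal_graph X p) p w)
                  (fiber_graph X p w))"

subsection \<open>Cayley graphs and generating sets\<close>

definition symmetric_subset :: "('g, 'm) monoid_scheme \<Rightarrow> 'g set \<Rightarrow> bool" where
  "symmetric_subset G S \<longleftrightarrow> S \<subseteq> carrier G \<and> (\<forall>s\<in>S. inv\<^bsub>G\<^esub> s \<in> S)"

definition symmetric_generators :: "('g, 'm) monoid_scheme \<Rightarrow> 'g set \<Rightarrow> bool" where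
  "symmetric_generators G S \<longleftrightarrow>
     symmetric_subset G S \<and> \<one>\<^bsub>G\<^esub> \<notin> S \<and> generate G S = carrier G"

definition cayley_graph :: "('g, 'm) monoid_scheme \<Rightarrow> 'g set \<Rightarrow> 'g pair_pre_digraph" where
  "cayley_graph G S =
     \<lparr> pverts = carrier G,
       parcs = {(x, y). x \<in> carrier G \<and> y \<in> carrier G \<and> (\<exists>s\<in>S. y = x \<otimes>\<^bsub>G\<^esub> s)} \<rparr>"

definition kernel_group ::
    "('a, 'm) monoid_scheme \<Rightarrow> ('b, 'n) monoid_scheme \<Rightarrow> ('a \<Rightarrow> 'b) \<Rightarrow> ('a, 'm) monoid_scheme" where
  "kernel_group A B \<phi> = A\<lparr>carrier := kernel A B \<phi>\<rparr>"

text \<open>The function \<open>\<sigma>\<close> is the indexing of the section by the (distinct) elements of \<open>S\<^sub>1\<close>.\<close>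

definition transversal_section ::
    "('a, 'm) monoid_scheme \<Rightarrow> ('a \<Rightarrow> 'b) \<Rightarrow> 'b set \<Rightarrow> 'a set \<Rightarrow> bool" where
  "transversal_section A \<phi> S\<^sub>1 T \<longleftrightarrow>
     symmetric_subset A T \<and> (\<exists>\<sigma>. T = \<sigma> ` S\<^sub>1 \<and> (\<forall>s\<in>S\<^sub>1. \<phi> (\<sigma> s) = s))"

definition admissible_generators ::
    "('a, 'm) monoid_scheme \<Rightarrow> ('b, 'n) monoid_scheme \<Rightarrow> ('a \<Rightarrow> 'b) \<Rightarrow> 'a set \<Rightarrow> bool" where
  "admissible_generators A B \<phi> S\<^sub>0 \<longleftrightarrow>
     symmetric_generators (kernel_group A B \<phi>) S\<^sub>0 \<and>
     (\<forall>a\<in>carrier A. (\<lambda>s. a \<otimes>\<^bsub>A\<^esub> s \<otimes>\<^bsub>A\<^esub> inv\<^bsub>A\<^esub> a) ` S\<^sub>0 \<subseteq> S\<^sub>0)"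

text \<open>
  The induced set \<open>S\<^sub>0 \<union> T\<close> is indeed a symmetric system of generators of \<open>A\<close> without the
  identity, so its Cayley graph is meaningful.
\<close>

lemma induced_symmetric_generators:
  assumes A: "group A" and B: "group B" and epi: "\<phi> \<in> epi A B"
    and S1: "symmetric_generators B S\<^sub>1"
    and T: "transversal_section A \<phi> S\<^sub>1 T"
    and S0: "admissible_generators A B \<phi> S\<^sub>0"
  shows "symmetric_generators A (S\<^sub>0 \<union> T)"
proof -
  interpret group_hom A B \<phi>
    using A B epi by (simp add: group_hom_def group_hom_axioms_def epi_def)
  have surj: "\<phi> ` carrier A = carrier B"
    using epi by (simp add: epi_def)
  let ?K = "kernel A B \<phi>"
  have sub: "subgroup ?K A" by (rule subgroup_kernel)
  obtain \<sigma> where \<sigma>: "T = \<sigma> ` S\<^sub>1" "\<And>s. s \<in> S\<^sub>1 \<Longrightarrow> \<phi> (\<sigma> s) = s"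
    using T by (auto simp: transversal_section_def)
  have T': "symmetric_subset A T" using T by (simp add: transversal_section_def)
  have S1': "\<one>\<^bsub>B\<^esub> \<notin> S\<^sub>1" "generate B S\<^sub>1 = carrier B"
    using S1 by (auto simp: symmetric_generators_def)
  have S0': "S\<^sub>0 \<subseteq> ?K" "\<one>\<^bsub>A\<^esub> \<notin> S\<^sub>0" "generate (A\<lparr>carrier := ?K\<rparr>) S\<^sub>0 = ?K"
      "\<And>s. s \<in> S\<^sub>0 \<Longrightarrow> inv\<^bsub>A\<lparr>carrier := ?K\<rparr>\<^esub> s \<in> S\<^sub>0"
    using S0 by (auto simp: admissible_generators_def symmetric_generators_def
        symmetric_subset_def kernel_group_def)
  have KA: "?K \<subseteq> carrier A" by (auto simp: kernel_def)
  have inv0: "inv\<^bsub>A\<^esub> s \<in> S\<^sub>0" if "s \<in> S\<^sub>0" for s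
    using S0'(4)[OF that] G.m_inv_consistent[OF sub] that S0'(1) by auto
  have sym: "symmetric_subset A (S\<^sub>0 \<union> T)"
    using T' S0'(1) KA inv0 by (auto simp: symmetric_subset_def)
  then have inA: "S\<^sub>0 \<union> T \<subseteq> carrier A" by (simp add: symmetric_subset_def)
  have "\<one>\<^bsub>A\<^esub> \<notin> T"
    using \<sigma> S1'(1) by (metis hom_one imageE)
  moreover have "carrier A \<subseteq> generate A (S\<^sub>0 \<union> T)"
  proof
    fix a assume a: "a \<in> carrier A"
    have "\<phi> a \<in> generate B (\<phi> ` T)"
    proof -
      have "\<phi> ` T = S\<^sub>1" using \<sigma> by force
      then show ?thesis using a S1'(2) by simp
    qed
    then obtain t where t: "t \<in> generate A T" "\<phi> t = \<phi> a"
      using generate_img[of T] inA by auto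
    have tA: "t \<in> carrier A"
      using t(1) inA G.generate_in_carrier by blast
    have "a \<otimes>\<^bsub>A\<^esub> inv\<^bsub>A\<^esub> t \<in> ?K"
      using a tA t(2) by (simp add: kernel_def)
    moreover have "?K = generate A S\<^sub>0"
      using G.generate_consistent[OF S0'(1) sub] S0'(3) by simp
    ultimately have "a \<otimes>\<^bsub>A\<^esub> inv\<^bsub>A\<^esub> t \<in> generate A (S\<^sub>0 \<union> T)"
      using G.mono_generate[of S\<^sub>0 "S\<^sub>0 \<union> T"] by auto
    moreover have "t \<in> generate A (S\<^sub>0 \<union> T)"
      using t(1) G.mono_generate[of T "S\<^sub>0 \<union> T"] by auto
    ultimately have "a \<otimes>\<^bsub>A\<^esub> inv\<^bsub>A\<^esub> t \<otimes>\<^bsub>A\<^esub> t \<in> generate A (S\<^sub>0 \<union> T)"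
      by (rule generate.eng)
    then show "a \<in> generate A (S\<^sub>0 \<union> T)"
      using a tA by (simp add: G.m_assoc)
  qed
  ultimately show ?thesis
    using sym S0'(2) G.generate_incl[OF inA] by (auto simp: symmetric_generators_def)
qed

end

theory Submission
  imports Defs
begin

text \<open>
  The arcs of \<open>Cay(A, S\<^sub>0 \<union> T)\<close> labelled by \<open>T\<close> are exactly the horizontal ones, and those labelled
  by \<open>S\<^sub>0\<close> stay inside the fibers. As \<open>T\<close> has exactly one element over each \<open>s \<in> S\<^sub>1\<close>, the
  horizontal graph \<open>Cay(A, T)\<close> covers \<open>Cay(B, S\<^sub>1)\<close>. The fibers are the cosets of the kernel, so left
  multiplication identifies each of them with \<open>Cay(ker \<phi>, S\<^sub>0)\<close>. Transport along an edge labelled by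
  \<open>s\<close> is right multiplication by the lift \<open>t\<close> of \<open>s\<close>; it replaces the difference \<open>x\<inverse>y\<close> by
  \<open>t\<inverse>(x\<inverse>y)t\<close>, so it preserves adjacency in the fibers because \<open>S\<^sub>0\<close> is closed under conjugation.
\<close>

section \<open>Simple graphs as relations, and their stars\<close>

lemma pair_bidirected_digraph_iff:
  "pair_bidirected_digraph G \<longleftrightarrow>
     parcs G \<subseteq> pverts G \<times> pverts G \<and> sym (parcs G) \<and> irrefl (parcs G)"
proof
  assume "pair_bidirected_digraph G"
  then interpret pair_bidirected_digraph G .
  have "parcs G \<subseteq> pverts G \<times> pverts G"
    using in_arcsD1 in_arcsD2 by auto
  moreover have "sym (parcs G)" using arcs_symmetric by (intro symI)
  moreover have "irrefl (parcs G)" using pair_no_loops by (intro irreflI) fastforce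
  ultimately show "parcs G \<subseteq> pverts G \<times> pverts G \<and> sym (parcs G) \<and> irrefl (parcs G)"
    by blast
next
  assume "parcs G \<subseteq> pverts G \<times> pverts G \<and> sym (parcs G) \<and> irrefl (parcs G)"
  then show "pair_bidirected_digraph G"
    by unfold_locales (auto simp: symmetric_def irrefl_def)
qed

lemma pair_bidirected_digraph_neighborhood:
  assumes "pair_bidirected_digraph G" "v \<in> pverts G"
  shows "pair_bidirected_digraph (neighborhood G v)"
  using assms by (auto simp: pair_bidirected_digraph_iff neighborhood_def sym_def irrefl_def)

lemma pair_bidirected_digraph_fiber_graph:
  assumes "pair_bidirected_digraph X"
  shows "pair_bidirected_digraph (fiber_graph X p v)"
  using assms by (auto simp: pair_bidirected_digraph_iff fiber_graph_def sym_def irrefl_def)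

text \<open>The neighborhoods are stars, so a bijection of the leaves is enough.\<close>

lemma graph_iso_neighborhoodI:
  assumes "pair_bidirected_digraph G" "pair_bidirected_digraph H"
    and "v \<in> pverts G" "f v \<in> pverts H"
    and bij: "bij_betw f {w. (v, w) \<in> parcs G} {w. (f v, w) \<in> parcs H}"
  shows "graph_iso (neighborhood G v) f (neighborhood H (f v))"
proof -
  have symG: "\<And>x y. (x, y) \<in> parcs G \<Longrightarrow> (y, x) \<in> parcs G" and irrG: "\<And>x. (x, x) \<notin> parcs G"
    and symH: "\<And>x y. (x, y) \<in> parcs H \<Longrightarrow> (y, x) \<in> parcs H" and irrH: "\<And>x. (x, x) \<notin> parcs H"
    using assms(1,2) by (auto simp: pair_bidirected_digraph_iff irrefl_def dest: symD)
  have image: "(f v, f w) \<in> parcs H" if "(v, w) \<in> parcs G" for w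
    using bij that by (auto simp: bij_betw_def)
  \<comment> \<open>Neither graph has loops, so on both sides the centre is not among its own leaves
    and can be added to the bijection.\<close>
  have "bij_betw f (insert v {w. (v, w) \<in> parcs G}) (insert (f v) {w. (f v, w) \<in> parcs H})"
    using notIn_Un_bij_betw[of v "{w. (v, w) \<in> parcs G}" f "{w. (f v, w) \<in> parcs H}"]
      bij irrG irrH by simp
  \<comment> \<open>Every arc of a star meets its centre. A leaf is never sent to
    \<open>f v\<close>, as \<open>H\<close> has no loops, so the centres correspond and hence so do
    the arcs.\<close>
  moreover have "(x, y) \<in> parcs (neighborhood G v) \<longleftrightarrow> (f x, f y) \<in> parcs (neighborhood H (f v))"
    if "x \<in> pverts (neighborhood G v)" "y \<in> pverts (neighborhood G v)" for x y
    using that image symG symH irrG irrH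
    by (simp add: neighborhood_def) metis
  ultimately show ?thesis
    using assms by (simp add: graph_iso_def pair_bidirected_digraph_neighborhood)
      (simp add: neighborhood_def)
qed

section \<open>Adjacency in a Cayley graph as a condition on the difference of two vertices\<close>

context group
begin

lemma inv_mult_eq_one_iff:
  assumes "x \<in> carrier G" "y \<in> carrier G"
  shows "inv x \<otimes> y = \<one> \<longleftrightarrow> x = y"
  using assms inv_solve_left'[of \<one> x y] by auto

text \<open>Solving \<open>y = x \<otimes> s\<close> for \<open>s\<close> removes the existential:
  the label of an arc is determined by its endpoints. All later arguments on arcs compute with this
  difference.\<close>

lemma cayley_graph_arc_iff:
  assumes "S \<subseteq> carrier G"
  shows "(x, y) \<in> parcs (cayley_graph G S) \<longleftrightarrow> x \<in> carrier G \<and> y \<in> carrier G \<and> inv x \<otimes> y \<in> S"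
proof -
  have "(\<exists>s\<in>S. y = x \<otimes> s) \<longleftrightarrow> inv x \<otimes> y \<in> S" if xy: "x \<in> carrier G" "y \<in> carrier G"
  proof -
    have "(\<exists>s\<in>S. y = x \<otimes> s) \<longleftrightarrow> (\<exists>s\<in>S. inv x \<otimes> y = s)"
    proof (rule bex_cong[OF refl])
      fix s assume "s \<in> S"
      then show "y = x \<otimes> s \<longleftrightarrow> inv x \<otimes> y = s"
        using xy assms inv_solve_left'[of s x y] by (simp add: subset_iff)
    qed
    then show ?thesis by simp
  qed
  then show ?thesis by (auto simp: cayley_graph_def)
qed

text \<open>Reversing an arc inverts its label, which gives symmetry; a loop would have label
  \<open>\<one>\<close>.\<close>

lemma pair_bidirected_digraph_cayley_graph:
  assumes "symmetric_subset G S" "\<one> \<notin> S"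
  shows "pair_bidirected_digraph (cayley_graph G S)"
proof -
  have S: "S \<subseteq> carrier G" and inv: "\<And>s. s \<in> S \<Longrightarrow> inv s \<in> S"
    using assms(1) by (auto simp: symmetric_subset_def)
  have "inv y \<otimes> x \<in> S" if "x \<in> carrier G" "y \<in> carrier G" "inv x \<otimes> y \<in> S" for x y
    using inv[OF that(3)] that by (simp add: inv_mult_group)
  then show ?thesis
    using assms(2) S
    by (auto simp: pair_bidirected_digraph_iff cayley_graph_arc_iff sym_def irrefl_def)
      (auto simp: cayley_graph_def)
qed

end

section \<open>The extension, its generators and the labels of arcs\<close>

text \<open>The lift \<open>\<sigma>\<close> is a parameter, so that neighbours and transport get
  explicit formulas. Inverses of elements of \<open>S\<^sub>0\<close> are taken in \<open>A\<close>,
  which keeps the kernel group out of the computations.\<close>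

locale cayley_extension = group_hom A B \<phi>
  for A :: "('a, 'm) monoid_scheme" (structure) and B :: "('b, 'n) monoid_scheme" (structure)
    and \<phi> :: "'a \<Rightarrow> 'b" +
  fixes S\<^sub>1 :: "'b set" and T S\<^sub>0 :: "'a set" and \<sigma> :: "'b \<Rightarrow> 'a"
  assumes surj: "\<phi> ` carrier A = carrier B"
    and sym_base: "symmetric_subset B S\<^sub>1" and one_notin_base: "\<one>\<^bsub>B\<^esub> \<notin> S\<^sub>1"
    and sym_section: "symmetric_subset A T" and section_eq: "T = \<sigma> ` S\<^sub>1"
    and hom_section: "s \<in> S\<^sub>1 \<Longrightarrow> \<phi> (\<sigma> s) = s"
    and fiber_subset: "S\<^sub>0 \<subseteq> kernel A B \<phi>"
    and sym_fiber: "k \<in> S\<^sub>0 \<Longrightarrow> inv\<^bsub>A\<^esub> k \<in> S\<^sub>0" and one_notin_fiber: "\<one>\<^bsub>A\<^esub> \<notin> S\<^sub>0"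
    and conj_fiber: "\<lbrakk>a \<in> carrier A; k \<in> S\<^sub>0\<rbrakk> \<Longrightarrow> a \<otimes>\<^bsub>A\<^esub> k \<otimes>\<^bsub>A\<^esub> inv\<^bsub>A\<^esub> a \<in> S\<^sub>0"
begin

abbreviation total_graph :: "'a pair_pre_digraph" where
  "total_graph \<equiv> cayley_graph A (S\<^sub>0 \<union> T)"

abbreviation base_graph :: "'b pair_pre_digraph" where
  "base_graph \<equiv> cayley_graph B S\<^sub>1"

abbreviation model_fiber :: "'a pair_pre_digraph" where
  "model_fiber \<equiv> cayley_graph (kernel_group A B \<phi>) S\<^sub>0"

lemma base_in_carrier: "s \<in> S\<^sub>1 \<Longrightarrow> s \<in> carrier B"
  using sym_base by (auto simp: symmetric_subset_def)

lemma section_in_carrier: "t \<in> T \<Longrightarrow> t \<in> carrier A"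
  using sym_section by (auto simp: symmetric_subset_def)

lemma fiber_in_carrier: "s \<in> S\<^sub>0 \<Longrightarrow> s \<in> carrier A"
  and hom_fiber: "s \<in> S\<^sub>0 \<Longrightarrow> \<phi> s = \<one>\<^bsub>B\<^esub>"
  using fiber_subset by (auto simp: kernel_def)

lemma lift_in_carrier: "s \<in> S\<^sub>1 \<Longrightarrow> \<sigma> s \<in> carrier A"
  using section_in_carrier section_eq by blast

lemma hom_in_base: "t \<in> T \<Longrightarrow> \<phi> t \<in> S\<^sub>1"
  using hom_section section_eq by auto

text \<open>Thus \<open>\<phi>\<close> is injective on \<open>T\<close> with inverse
  \<open>\<sigma>\<close>, which is what makes lifts of arcs unique.\<close>

lemma section_unique: "t \<in> T \<Longrightarrow> t = \<sigma> (\<phi> t)"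
  using hom_section section_eq by auto

lemma hom_section_neq_one: "t \<in> T \<Longrightarrow> \<phi> t \<noteq> \<one>\<^bsub>B\<^esub>"
  using hom_in_base one_notin_base by metis

lemma hom_quotient_eq_one_iff:
  "\<lbrakk>x \<in> carrier A; y \<in> carrier A\<rbrakk> \<Longrightarrow> \<phi> (inv\<^bsub>A\<^esub> x \<otimes>\<^bsub>A\<^esub> y) = \<one>\<^bsub>B\<^esub> \<longleftrightarrow> \<phi> x = \<phi> y"
  using H.inv_mult_eq_one_iff[of "\<phi> x" "\<phi> y"] by simp

lemma fiber_quotient:
  "\<lbrakk>x \<in> carrier A; y \<in> carrier A; inv\<^bsub>A\<^esub> x \<otimes>\<^bsub>A\<^esub> y \<in> S\<^sub>0\<rbrakk> \<Longrightarrow> \<phi> x = \<phi> y"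
  using hom_quotient_eq_one_iff[of x y] hom_fiber by blast

lemma section_quotient:
  "\<lbrakk>x \<in> carrier A; y \<in> carrier A; inv\<^bsub>A\<^esub> x \<otimes>\<^bsub>A\<^esub> y \<in> T\<rbrakk> \<Longrightarrow> \<phi> x \<noteq> \<phi> y"
  using hom_quotient_eq_one_iff[of x y] hom_section_neq_one by blast

lemma total_arc_iff:
  "(x, y) \<in> parcs total_graph \<longleftrightarrow> x \<in> carrier A \<and> y \<in> carrier A \<and> inv\<^bsub>A\<^esub> x \<otimes>\<^bsub>A\<^esub> y \<in> S\<^sub>0 \<union> T"
  using fiber_in_carrier section_in_carrier by (intro G.cayley_graph_arc_iff) auto

lemma section_arc_iff:
  "(x, y) \<in> parcs (cayley_graph A T) \<longleftrightarrow>
     x \<in> carrier A \<and> y \<in> carrier A \<and> inv\<^bsub>A\<^esub> x \<otimes>\<^bsub>A\<^esub> y \<in> T"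
  using section_in_carrier by (intro G.cayley_graph_arc_iff) auto

lemma base_arc_iff:
  "(v, w) \<in> parcs base_graph \<longleftrightarrow> v \<in> carrier B \<and> w \<in> carrier B \<and> inv\<^bsub>B\<^esub> v \<otimes>\<^bsub>B\<^esub> w \<in> S\<^sub>1"
  using base_in_carrier by (intro H.cayley_graph_arc_iff) auto

lemma group_kernel_group: "group (kernel_group A B \<phi>)"
  unfolding kernel_group_def
  by (rule subgroup.subgroup_is_group[OF subgroup_kernel G.group_axioms])

lemma inv_kernel_group:
  "k \<in> kernel A B \<phi> \<Longrightarrow> inv\<^bsub>kernel_group A B \<phi>\<^esub> k = inv\<^bsub>A\<^esub> k"
  unfolding kernel_group_def by (rule G.m_inv_consistent[OF subgroup_kernel])

lemma kernel_group_simps: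
  "carrier (kernel_group A B \<phi>) = kernel A B \<phi>"
  "\<one>\<^bsub>kernel_group A B \<phi>\<^esub> = \<one>\<^bsub>A\<^esub>"
  "x \<otimes>\<^bsub>kernel_group A B \<phi>\<^esub> y = x \<otimes>\<^bsub>A\<^esub> y"
  by (simp_all add: kernel_group_def)

text \<open>Inverses in the kernel group agree with those of \<open>A\<close>, so the model fiber
  and the actual fibers are described by the same difference.\<close>

lemma model_fiber_arc_iff:
  "(x, y) \<in> parcs model_fiber \<longleftrightarrow>
     x \<in> kernel A B \<phi> \<and> y \<in> kernel A B \<phi> \<and> inv\<^bsub>A\<^esub> x \<otimes>\<^bsub>A\<^esub> y \<in> S\<^sub>0"
  using group.cayley_graph_arc_iff[OF group_kernel_group, of S\<^sub>0 x y] fiber_subset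
    inv_kernel_group[of x]
  by (simp add: kernel_group_simps cong: conj_cong)

lemma bidirected_total: "pair_bidirected_digraph total_graph"
proof (rule G.pair_bidirected_digraph_cayley_graph)
  show "symmetric_subset A (S\<^sub>0 \<union> T)"
    using sym_section sym_fiber fiber_in_carrier by (auto simp: symmetric_subset_def)
  show "\<one>\<^bsub>A\<^esub> \<notin> S\<^sub>0 \<union> T"
    \<comment> \<open>The identity is not in \<open>T\<close>: elements of \<open>T\<close> have
      nontrivial image under \<open>\<phi>\<close>.\<close>
    using one_notin_fiber hom_section_neq_one[of "\<one>\<^bsub>A\<^esub>"] by auto
qed

lemma bidirected_section: "pair_bidirected_digraph (cayley_graph A T)"
  using G.pair_bidirected_digraph_cayley_graph[OF sym_section]
    hom_section_neq_one[of "\<one>\<^bsub>A\<^esub>"]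
  by auto

lemma bidirected_base: "pair_bidirected_digraph base_graph"
  by (rule H.pair_bidirected_digraph_cayley_graph[OF sym_base one_notin_base])

lemma bidirected_model_fiber: "pair_bidirected_digraph model_fiber"
proof (rule group.pair_bidirected_digraph_cayley_graph[OF group_kernel_group])
  show "symmetric_subset (kernel_group A B \<phi>) S\<^sub>0"
    unfolding symmetric_subset_def kernel_group_simps
    using fiber_subset sym_fiber inv_kernel_group by (metis subsetD)
  show "\<one>\<^bsub>kernel_group A B \<phi>\<^esub> \<notin> S\<^sub>0"
    using one_notin_fiber by (simp add: kernel_group_simps)
qed

lemma section_arc_hom: "(x, y) \<in> parcs (cayley_graph A T) \<Longrightarrow> (\<phi> x, \<phi> y) \<in> parcs base_graph"
  using hom_in_base[of "inv\<^bsub>A\<^esub> x \<otimes>\<^bsub>A\<^esub> y"] by (auto simp: section_arc_iff base_arc_iff)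

section \<open>The projection and the horizontal graph\<close>

text \<open>A label in \<open>S\<^sub>0\<close> has trivial image and keeps the fiber; a label in
  \<open>T\<close> has image in \<open>S\<^sub>1\<close>, hence nontrivial, and leaves it.\<close>

lemma horizontal_total: "horizontal_graph total_graph \<phi> = cayley_graph A T"
proof -
  have "parcs (horizontal_graph total_graph \<phi>) = parcs (cayley_graph A T)"
    using fiber_quotient section_quotient
    by (auto simp: horizontal_graph_def total_arc_iff section_arc_iff)
  then show ?thesis
    by (simp add: horizontal_graph_def cayley_graph_def)
qed

lemma surj_graph_morphism_total: "surj_graph_morphism total_graph \<phi> base_graph"
proof -
  have "(\<phi> x, \<phi> y) \<in> parcs base_graph \<or> \<phi> x = \<phi> y" if "(x, y) \<in> parcs total_graph" for x y
    using that section_arc_hom[of x y] fiber_quotient[of x y]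
    by (auto simp: total_arc_iff section_arc_iff)
  then show ?thesis
    using bidirected_total bidirected_base surj
    by (auto simp: surj_graph_morphism_def graph_morphism_def) (auto simp: cayley_graph_def)
qed

lemma surj_graph_morphism_section: "surj_graph_morphism (cayley_graph A T) \<phi> base_graph"
  using bidirected_section bidirected_base surj section_arc_hom
  by (auto simp: surj_graph_morphism_def graph_morphism_def) (auto simp: cayley_graph_def)

section \<open>Fibers as cosets of the kernel\<close>

lemma fiber_set_cayley_graph: "fiber_set (cayley_graph A S) \<phi> v = {x \<in> carrier A. \<phi> x = v}"
  by (simp add: fiber_set_def cayley_graph_def)

lemma pverts_fiber_graph: "pverts (fiber_graph total_graph \<phi> v) = {x \<in> carrier A. \<phi> x = v}"
  by (simp add: fiber_graph_def fiber_set_cayley_graph)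

lemma pverts_model_fiber: "pverts model_fiber = kernel A B \<phi>"
  by (simp add: cayley_graph_def kernel_group_def)

text \<open>Only labels in \<open>S\<^sub>0\<close> survive inside a fiber, since a label in
  \<open>T\<close> would change the image.\<close>

lemma fiber_graph_arc_iff:
  "(x, y) \<in> parcs (fiber_graph total_graph \<phi> v) \<longleftrightarrow>
     x \<in> carrier A \<and> y \<in> carrier A \<and> \<phi> x = v \<and> \<phi> y = v \<and> inv\<^bsub>A\<^esub> x \<otimes>\<^bsub>A\<^esub> y \<in> S\<^sub>0"
  using section_quotient[of x y]
  by (auto simp: fiber_graph_def fiber_set_cayley_graph total_arc_iff)

text \<open>The fiber through \<open>a\<close> is the left coset of the kernel by \<open>a\<close>;
  left multiplication by \<open>a\<close> is the inverse map.\<close>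

lemma bij_betw_fiber_kernel:
  assumes a: "a \<in> carrier A"
  shows "bij_betw (\<lambda>x. inv\<^bsub>A\<^esub> a \<otimes>\<^bsub>A\<^esub> x) {x \<in> carrier A. \<phi> x = \<phi> a} (kernel A B \<phi>)"
  by (rule bij_betw_byWitness[where f' = "\<lambda>k. a \<otimes>\<^bsub>A\<^esub> k"])
    (use a in \<open>auto simp: kernel_def simp flip: G.m_assoc\<close>)

text \<open>Left translation by \<open>inv a\<close> does not change the difference of two vertices,
  so it preserves and reflects arcs.\<close>

lemma isomorphic_fiber:
  assumes "v \<in> carrier B"
  shows "isomorphic_graphs (fiber_graph total_graph \<phi> v) model_fiber"
proof -
  obtain a where a: "a \<in> carrier A" "\<phi> a = v"
    using assms unfolding surj[symmetric] by auto
  have "inv\<^bsub>A\<^esub> (inv\<^bsub>A\<^esub> a \<otimes>\<^bsub>A\<^esub> x) \<otimes>\<^bsub>A\<^esub> (inv\<^bsub>A\<^esub> a \<otimes>\<^bsub>A\<^esub> y) = inv\<^bsub>A\<^esub> x \<otimes>\<^bsub>A\<^esub> y"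
    if "x \<in> carrier A" "y \<in> carrier A" for x y
  proof -
    have "inv\<^bsub>A\<^esub> (inv\<^bsub>A\<^esub> a \<otimes>\<^bsub>A\<^esub> x) \<otimes>\<^bsub>A\<^esub> (inv\<^bsub>A\<^esub> a \<otimes>\<^bsub>A\<^esub> y) =
        inv\<^bsub>A\<^esub> x \<otimes>\<^bsub>A\<^esub> (a \<otimes>\<^bsub>A\<^esub> (inv\<^bsub>A\<^esub> a \<otimes>\<^bsub>A\<^esub> y))"
      using that a(1) by (simp add: G.inv_mult_group G.m_assoc)
    also have "a \<otimes>\<^bsub>A\<^esub> (inv\<^bsub>A\<^esub> a \<otimes>\<^bsub>A\<^esub> y) = y"
      using that(2) a(1) by (simp flip: G.m_assoc)
    finally show ?thesis .
  qed
  moreover have "inv\<^bsub>A\<^esub> a \<otimes>\<^bsub>A\<^esub> x \<in> kernel A B \<phi>" if "x \<in> carrier A" "\<phi> x = v" for x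
    using that a bij_betw_apply[OF bij_betw_fiber_kernel[OF a(1)], of x] by simp
  ultimately have "graph_iso (fiber_graph total_graph \<phi> v) (\<lambda>x. inv\<^bsub>A\<^esub> a \<otimes>\<^bsub>A\<^esub> x) model_fiber"
    using bij_betw_fiber_kernel[OF a(1)] a(2) bidirected_model_fiber
      pair_bidirected_digraph_fiber_graph[OF bidirected_total]
    by (simp add: graph_iso_def pverts_fiber_graph pverts_model_fiber fiber_graph_arc_iff
        model_fiber_arc_iff)
  then show ?thesis by (auto simp: isomorphic_graphs_def)
qed

lemma card_fiber:
  assumes "v \<in> carrier B"
  shows "card {x \<in> carrier A. \<phi> x = v} = card (kernel A B \<phi>)"
proof -
  obtain a where a: "a \<in> carrier A" "\<phi> a = v"
    using assms unfolding surj[symmetric] by auto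
  show ?thesis
    using bij_betw_same_card[OF bij_betw_fiber_kernel[OF a(1)]] a(2) by simp
qed

section \<open>Unique lifting of arcs and the covering\<close>

text \<open>The label of a horizontal arc from \<open>x\<close> to a vertex over \<open>w\<close>
  lies in \<open>T\<close> over the label of the base arc, and \<open>\<sigma>\<close> gives the
  only such element. This yields both the covering property and the value of the transport.\<close>

lemma section_neighbor:
  assumes x: "x \<in> carrier A" and arc: "(\<phi> x, w) \<in> parcs base_graph"
  shows "(x, y) \<in> parcs (cayley_graph A T) \<and> \<phi> y = w \<longleftrightarrow>
    y = x \<otimes>\<^bsub>A\<^esub> \<sigma> (inv\<^bsub>B\<^esub> (\<phi> x) \<otimes>\<^bsub>B\<^esub> w)"
proof
  assume y: "(x, y) \<in> parcs (cayley_graph A T) \<and> \<phi> y = w"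
  then have "inv\<^bsub>A\<^esub> x \<otimes>\<^bsub>A\<^esub> y = \<sigma> (inv\<^bsub>B\<^esub> (\<phi> x) \<otimes>\<^bsub>B\<^esub> w)"
    using section_unique[of "inv\<^bsub>A\<^esub> x \<otimes>\<^bsub>A\<^esub> y"] by (simp add: section_arc_iff)
  then show "y = x \<otimes>\<^bsub>A\<^esub> \<sigma> (inv\<^bsub>B\<^esub> (\<phi> x) \<otimes>\<^bsub>B\<^esub> w)"
    using x y by (metis G.inv_closed G.inv_solve_left G.m_closed section_arc_iff)
next
  let ?s = "inv\<^bsub>B\<^esub> (\<phi> x) \<otimes>\<^bsub>B\<^esub> w"
  assume y: "y = x \<otimes>\<^bsub>A\<^esub> \<sigma> ?s"
  have s: "?s \<in> S\<^sub>1" "w \<in> carrier B" using arc by (auto simp: base_arc_iff)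
  have "inv\<^bsub>A\<^esub> x \<otimes>\<^bsub>A\<^esub> y = \<sigma> ?s"
    using x y lift_in_carrier[OF s(1)] by (simp flip: G.m_assoc)
  moreover have "\<phi> y = w"
    using x y s lift_in_carrier[OF s(1)] by (simp add: hom_section flip: H.m_assoc)
  moreover have "\<sigma> ?s \<in> T" using s(1) section_eq by blast
  moreover have "y \<in> carrier A" using x y lift_in_carrier[OF s(1)] by simp
  ultimately show "(x, y) \<in> parcs (cayley_graph A T) \<and> \<phi> y = w"
    using x by (simp add: section_arc_iff)
qed

lemma graph_iso_neighborhood:
  assumes x: "x \<in> carrier A"
  shows "graph_iso (neighborhood (cayley_graph A T) x) \<phi> (neighborhood base_graph (\<phi> x))"
proof (rule graph_iso_neighborhoodI[OF bidirected_section bidirected_base])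
  show "x \<in> pverts (cayley_graph A T)" "\<phi> x \<in> pverts base_graph"
    using x by (auto simp: cayley_graph_def)
  show "bij_betw \<phi> {y. (x, y) \<in> parcs (cayley_graph A T)} {w. (\<phi> x, w) \<in> parcs base_graph}"
  proof (rule bij_betw_byWitness)
    \<comment> \<open>The inverse of \<open>\<phi>\<close> on leaves: lift the label of the base arc
      and start at \<open>x\<close>.\<close>
    let ?lift = "\<lambda>w. x \<otimes>\<^bsub>A\<^esub> \<sigma> (inv\<^bsub>B\<^esub> (\<phi> x) \<otimes>\<^bsub>B\<^esub> w)"
    have lift: "(x, ?lift w) \<in> parcs (cayley_graph A T) \<and> \<phi> (?lift w) = w"
      if "(\<phi> x, w) \<in> parcs base_graph" for w
      using section_neighbor[OF x that] by simp
    have "?lift (\<phi> y) = y" if "(x, y) \<in> parcs (cayley_graph A T)" for y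
      using section_neighbor[OF x section_arc_hom[OF that], of y] that by simp
    then show "\<forall>y\<in>{y. (x, y) \<in> parcs (cayley_graph A T)}. ?lift (\<phi> y) = y" by blast
    show "\<forall>w\<in>{w. (\<phi> x, w) \<in> parcs base_graph}. \<phi> (?lift w) = w"
      and "?lift ` {w. (\<phi> x, w) \<in> parcs base_graph} \<subseteq> {y. (x, y) \<in> parcs (cayley_graph A T)}"
      using lift by auto
    show "\<phi> ` {y. (x, y) \<in> parcs (cayley_graph A T)} \<subseteq> {w. (\<phi> x, w) \<in> parcs base_graph}"
      using section_arc_hom by blast
  qed
qed

section \<open>Transport between fibers\<close>

text \<open>Unique lifting turns the predicate under \<open>THE\<close> into an equation for
  \<open>y\<close>, so the description is well defined.\<close>

lemma fiber_transport_section: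
  assumes "(\<phi> x, w) \<in> parcs base_graph" "x \<in> carrier A"
  shows "fiber_transport (cayley_graph A T) \<phi> w x = x \<otimes>\<^bsub>A\<^esub> \<sigma> (inv\<^bsub>B\<^esub> (\<phi> x) \<otimes>\<^bsub>B\<^esub> w)"
  using section_neighbor[OF assms(2,1)] by (simp add: fiber_transport_def)

text \<open>Admissibility gives one inclusion for each conjugating element; using it for
  \<open>t\<close> and for \<open>inv t\<close> gives both directions.\<close>

lemma conj_mem_iff:
  assumes t: "t \<in> carrier A" and z: "z \<in> carrier A"
  shows "inv\<^bsub>A\<^esub> t \<otimes>\<^bsub>A\<^esub> z \<otimes>\<^bsub>A\<^esub> t \<in> S\<^sub>0 \<longleftrightarrow> z \<in> S\<^sub>0"
proof
  assume "inv\<^bsub>A\<^esub> t \<otimes>\<^bsub>A\<^esub> z \<otimes>\<^bsub>A\<^esub> t \<in> S\<^sub>0"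
  from conj_fiber[OF t this] show "z \<in> S\<^sub>0"
    using t z by (simp add: G.m_assoc) (simp flip: G.m_assoc)
next
  assume "z \<in> S\<^sub>0"
  from conj_fiber[OF G.inv_closed[OF t] this] show "inv\<^bsub>A\<^esub> t \<otimes>\<^bsub>A\<^esub> z \<otimes>\<^bsub>A\<^esub> t \<in> S\<^sub>0"
    using t by simp
qed

lemma graph_iso_fiber_transport:
  assumes arc: "(v, w) \<in> parcs base_graph"
  shows "graph_iso (fiber_graph total_graph \<phi> v) (fiber_transport (cayley_graph A T) \<phi> w)
    (fiber_graph total_graph \<phi> w)"
proof -
  let ?s = "inv\<^bsub>B\<^esub> v \<otimes>\<^bsub>B\<^esub> w"
  let ?f = "fiber_transport (cayley_graph A T) \<phi> w"
  have s: "?s \<in> S\<^sub>1" "v \<in> carrier B" "w \<in> carrier B" using arc by (auto simp: base_arc_iff)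
  define t where "t = \<sigma> ?s"
  have t: "t \<in> carrier A" "\<phi> t = ?s"
    using s(1) by (simp_all add: t_def lift_in_carrier hom_section)
  \<comment> \<open>The base point \<open>\<phi> x = v\<close> is constant on the fiber, so one
    \<open>t\<close> serves all its vertices.\<close>
  have f: "?f x = x \<otimes>\<^bsub>A\<^esub> t" if "x \<in> carrier A" "\<phi> x = v" for x
    using fiber_transport_section[of x w] that arc by (simp add: t_def)
  have vt: "v \<otimes>\<^bsub>B\<^esub> \<phi> t = w" "w \<otimes>\<^bsub>B\<^esub> inv\<^bsub>B\<^esub> (\<phi> t) = v"
  proof -
    show "v \<otimes>\<^bsub>B\<^esub> \<phi> t = w"
      using s t(2) by (simp flip: H.m_assoc)
    then show "w \<otimes>\<^bsub>B\<^esub> inv\<^bsub>B\<^esub> (\<phi> t) = v"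
      using s t(1) by (metis H.inv_solve_right hom_closed)
  qed
  have "bij_betw (\<lambda>x. x \<otimes>\<^bsub>A\<^esub> t) {x \<in> carrier A. \<phi> x = v} {x \<in> carrier A. \<phi> x = w}"
    by (rule bij_betw_byWitness[where f' = "\<lambda>y. y \<otimes>\<^bsub>A\<^esub> inv\<^bsub>A\<^esub> t"])
      (use t(1) vt in \<open>auto simp: G.m_assoc\<close>)
  \<comment> \<open>The transport is known to be right multiplication only on this fiber, so
    bijectivity is transferred by congruence there.\<close>
  then have "bij_betw ?f {x \<in> carrier A. \<phi> x = v} {x \<in> carrier A. \<phi> x = w}"
    by (rule iffD1[OF bij_betw_cong, rotated]) (simp add: f)
  moreover have "(x, y) \<in> parcs (fiber_graph total_graph \<phi> v) \<longleftrightarrow>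
      (?f x, ?f y) \<in> parcs (fiber_graph total_graph \<phi> w)"
    if "x \<in> carrier A" "\<phi> x = v" "y \<in> carrier A" "\<phi> y = v" for x y
  proof -
    \<comment> \<open>Right translation conjugates the difference, and \<open>S\<^sub>0\<close> is
      invariant under conjugation.\<close>
    have "inv\<^bsub>A\<^esub> (x \<otimes>\<^bsub>A\<^esub> t) \<otimes>\<^bsub>A\<^esub> (y \<otimes>\<^bsub>A\<^esub> t) = inv\<^bsub>A\<^esub> t \<otimes>\<^bsub>A\<^esub> (inv\<^bsub>A\<^esub> x \<otimes>\<^bsub>A\<^esub> y) \<otimes>\<^bsub>A\<^esub> t"
      using that t(1) by (simp add: G.inv_mult_group G.m_assoc)
    then show ?thesis
      using that t(1) vt(1) conj_mem_iff[OF t(1), of "inv\<^bsub>A\<^esub> x \<otimes>\<^bsub>A\<^esub> y"]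
      by (simp add: f fiber_graph_arc_iff)
  qed
  ultimately show ?thesis
    by (simp add: graph_iso_def pverts_fiber_graph
        pair_bidirected_digraph_fiber_graph[OF bidirected_total])
qed

text \<open>The number of sheets is the order of the kernel, because each fiber is one of its
  cosets.\<close>

lemma graph_bundle_total:
  assumes fin: "finite (carrier A)"
  shows "graph_bundle model_fiber total_graph \<phi> base_graph"
proof -
  have pverts: "pverts base_graph = carrier B" "pverts (cayley_graph A T) = carrier A"
    by (simp_all add: cayley_graph_def)
  have "finite (kernel A B \<phi>)" using fin by (simp add: kernel_def)
  moreover have "fold_covering (card (kernel A B \<phi>)) (cayley_graph A T) \<phi> base_graph"
    using fin surj_graph_morphism_section card_fiber graph_iso_neighborhood
    by (simp add: fold_covering_def fiber_set_cayley_graph pverts)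
  ultimately show ?thesis
    using bidirected_model_fiber surj_graph_morphism_total isomorphic_fiber
      graph_iso_fiber_transport
    by (simp add: graph_bundle_def horizontal_total pverts pverts_model_fiber)
qed

end

theorem theorem5p6:
  fixes A :: "('a, 'm) monoid_scheme" and B :: "('b, 'n) monoid_scheme"
    and \<phi> :: "'a \<Rightarrow> 'b" and S\<^sub>1 :: "'b set" and T\<^sub>1 S\<^sub>0 S\<^sub>\<phi> :: "'a set"
  assumes "group A" and "finite (carrier A)"
    and "group B" and "finite (carrier B)"
    and "\<phi> \<in> epi A B"
    and "symmetric_generators B S\<^sub>1"
    and "transversal_section A \<phi> S\<^sub>1 T\<^sub>1"
    and "admissible_generators A B \<phi> S\<^sub>0"
    and "S\<^sub>\<phi> = S\<^sub>0 \<union> T\<^sub>1"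
  shows "graph_bundle (cayley_graph (kernel_group A B \<phi>) S\<^sub>0)
           (cayley_graph A S\<^sub>\<phi>) \<phi> (cayley_graph B S\<^sub>1)"
proof -
  interpret group_hom A B \<phi>
    using assms(1,3,5) by (simp add: group_hom_def group_hom_axioms_def epi_def)
  obtain \<sigma> where \<sigma>: "T\<^sub>1 = \<sigma> ` S\<^sub>1" "\<And>s. s \<in> S\<^sub>1 \<Longrightarrow> \<phi> (\<sigma> s) = s"
    using assms(7) by (auto simp: transversal_section_def)
  have S0: "S\<^sub>0 \<subseteq> kernel A B \<phi>" "\<one>\<^bsub>A\<^esub> \<notin> S\<^sub>0"
    "\<And>s. s \<in> S\<^sub>0 \<Longrightarrow> inv\<^bsub>kernel_group A B \<phi>\<^esub> s \<in> S\<^sub>0"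
    "\<And>a s. \<lbrakk>a \<in> carrier A; s \<in> S\<^sub>0\<rbrakk> \<Longrightarrow> a \<otimes>\<^bsub>A\<^esub> s \<otimes>\<^bsub>A\<^esub> inv\<^bsub>A\<^esub> a \<in> S\<^sub>0"
    using assms(8) by (auto simp: admissible_generators_def symmetric_generators_def
        symmetric_subset_def kernel_group_def image_subset_iff)
  \<comment> \<open>Symmetry of \<open>S\<^sub>0\<close> is given with the inverse of the kernel
    group and is moved to that of \<open>A\<close>.\<close>
  have "inv\<^bsub>A\<^esub> s \<in> S\<^sub>0" if "s \<in> S\<^sub>0" for s
    using S0(1) S0(3)[OF that] G.m_inv_consistent[OF subgroup_kernel, of s] that
    by (auto simp: kernel_group_def)
  then interpret cayley_extension A B \<phi> S\<^sub>1 T\<^sub>1 S\<^sub>0 \<sigma>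
    using assms(5-7) \<sigma> S0
    by unfold_locales
      (simp_all add: epi_def symmetric_generators_def transversal_section_def)
  show ?thesis
    using graph_bundle_total[OF assms(2)] assms(9) by simp
qed

end
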